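(* Let $n\ge 2$ be an integer and $\bar\beta_n=2/n$. Then the Lebesgue function of the point set $\mathcal{U}^{\bar\beta_n,0}_{n}$ satisfies $$\lambda\big(\mathcal{U}^{\bar\beta_n,0}_{n};-1\big)=2n-1.$$
   Context: For $\beta,\gamma\in[0,2)$ with $\beta+\gamma<2$ and an integer $n\ge2$, the set of $n$ $(\beta,\gamma)$-Chebyshev-Lobatto points is $$\mathcal{U}^{\beta,\gamma}_{n}=\Big\{\cos\Big(\frac{(2-\beta-\gamma)j\pi}{2(n-1)}+\frac{\gamma\pi}{2}\Big)\Big\}_{j=0,\dots,n-1}.$$ For a finite set $\mathcal{X}=\{x_0,\dots,x_{n-1}\}\subset[-1,1]$ of distinct points, with Lagrange polynomials $\ell_i(x)=\prod_{j\neq i}\frac{x-x_j}{x_i-x_j}$, the Lebesgue function is $\lambda(\mathcal{X};x)=\sum_{i=0}^{n-1}|\ell_i(x)|$, $x\in[-1,1]$. *)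

theory Defs
  imports Complex_Main
begin

definition CL_points :: "real \<Rightarrow> real \<Rightarrow> nat \<Rightarrow> real set" where
  "CL_points \<beta> \<gamma> n =
     (\<lambda>j. cos ((2 - \<beta> - \<gamma>) * real j * pi / (2 * (real n - 1)) + \<gamma> * pi / 2)) ` {0..n - 1}"

text \<open>Nodes are indexed by themselves: the Lagrange polynomial of \<open>X\<close> belonging to the
  node \<open>a \<in> X\<close>. The set \<open>X\<close> is meant to be finite.\<close>

definition lagrange_poly :: "real set \<Rightarrow> real \<Rightarrow> real \<Rightarrow> real" where
  "lagrange_poly X a x = (\<Prod>b\<in>X - {a}. (x - b) / (a - b))"

definition lebesgue_function :: "real set \<Rightarrow> real \<Rightarrow> real" where
  "lebesgue_function X x = (\<Sum>a\<in>X. \<bar>lagrange_poly X a x\<bar>)"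

end

theory Submission
  imports Defs "HOL-Computational_Algebra.Polynomial"
begin

text \<open>The nodes are \<open>cos (j * pi / n)\<close> for \<open>j < n\<close>, that is, the roots of
  \<open>W x = (x - 1) * U x\<close> with \<open>U\<close> the Chebyshev polynomial of the second kind of degree \<open>n - 1\<close>.
  The Lagrange polynomial of a node \<open>a\<close> is \<open>W x / ((x - a) * W' a)\<close>. Here
  \<open>\<bar>W (-1)\<bar> = 2 * n\<close>, and differentiating \<open>U (cos t) * sin t = sin (n * t)\<close> yields
  \<open>\<bar>(1 + a) * W' a\<bar> = n\<close> for every node \<open>a \<noteq> 1\<close>, while this quantity is \<open>2 * n\<close> for \<open>a = 1\<close>.
  So the node 1 contributes 1 and each of the \<open>n - 1\<close> others contributes 2.\<close>

text \<open>Induction on the roots: after the factor of \<open>a\<close> is divided out, the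
  quotient has degree one less and still vanishes on \<open>A\<close>, since \<open>a\<close> is not
  in \<open>A\<close> and there are no zero divisors.\<close>

lemma poly_eq_smult_prod_roots:
  fixes p :: "'a::idom poly"
  assumes "finite A" "\<And>a. a \<in> A \<Longrightarrow> poly p a = 0" "degree p = card A"
  shows "p = smult (lead_coeff p) (\<Prod>a\<in>A. [:-a, 1:])"
  using assms
proof (induction A arbitrary: p rule: finite_induct)
  case empty
  then show ?case by (auto elim: degree_eq_zeroE)
next
  case (insert a A)
  then obtain q where p: "p = [:-a, 1:] * q"
    using poly_eq_0_iff_dvd by (metis dvdE insertI1)
  have "q \<noteq> 0" using insert.prems(2) insert.hyps p by auto
  then have "degree p = Suc (degree q)" by (simp add: p degree_mult_eq del: mult_pCons_left)
  then have deg: "degree q = card A"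
    using insert by simp
  have "poly q b = 0" if "b \<in> A" for b
    using insert.prems(1)[of b] insert.hyps(2) that by (auto simp: p)
  from insert.IH[OF this deg]
  have q: "q = smult (lead_coeff q) (\<Prod>a\<in>A. [:-a, 1:])" .
  have "lead_coeff p = lead_coeff q" by (simp add: p lead_coeff_mult del: mult_pCons_left)
  then show ?case using insert.hyps q by (metis p mult_smult_right prod.insert)
qed

text \<open>With \<open>p = c * (x - a) * q\<close>, the product rule at \<open>a\<close> leaves
  only \<open>c * q a\<close>, while the Lagrange polynomial is \<open>q x / q a\<close>. The form
  without division also covers \<open>x = a\<close>.\<close>

lemma lagrange_poly_eq_pderiv:
  fixes p :: "real poly"
  assumes X: "finite X" "\<And>b. b \<in> X \<Longrightarrow> poly p b = 0" "degree p = card X" and a: "a \<in> X"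
  shows "lagrange_poly X a x * ((x - a) * poly (pderiv p) a) = poly p x"
proof -
  define q where "q = (\<Prod>b\<in>X - {a}. [:-b, 1:])"
  define c where "c = lead_coeff p"
  have p: "p = smult c ([:-a, 1:] * q)"
    using poly_eq_smult_prod_roots[OF X] prod.remove[OF X(1) a, of "\<lambda>b. [:-b, 1:]"]
    by (simp add: q_def c_def)
  have "poly q a \<noteq> 0"
    using X(1) by (auto simp: q_def poly_prod)
  moreover have "lagrange_poly X a x = poly q x / poly q a"
    by (simp add: lagrange_poly_def q_def poly_prod prod_dividef)
  moreover have "poly (pderiv p) a = c * poly q a"
    by (simp only: p pderiv_smult pderiv_mult) (simp add: pderiv_pCons)
  moreover have "poly p x = c * ((x - a) * poly q x)"
    by (simp only: p poly_smult poly_mult) simp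
  ultimately show ?thesis by simp
qed

fun cheb_U :: "nat \<Rightarrow> real poly" where
  "cheb_U 0 = 1"
| "cheb_U (Suc 0) = [:0, 2:]"
| "cheb_U (Suc (Suc n)) = [:0, 2:] * cheb_U (Suc n) - cheb_U n"

lemma degree_lead_coeff_cheb_U: "degree (cheb_U n) = n \<and> lead_coeff (cheb_U n) = 2 ^ n"
proof (induction n rule: cheb_U.induct)
  case (3 n)
  let ?p = "[:0, 2:] * cheb_U (Suc n)"
  have "cheb_U (Suc n) \<noteq> 0" using 3 by auto
  then have d: "degree ?p = Suc (Suc n)" using 3 by (simp add: degree_mult_eq del: mult_pCons_left)
  have l: "lead_coeff ?p = 2 ^ Suc (Suc n)"
    by (simp add: 3(1)[THEN conjunct2] lead_coeff_mult del: mult_pCons_left)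
  \<comment> \<open>The subtracted term has lower degree, so the leading term cannot cancel.\<close>
  have "degree (- cheb_U n) < degree ?p" using 3 d by simp
  then have "degree (- cheb_U n + ?p) = degree ?p" "lead_coeff (- cheb_U n + ?p) = lead_coeff ?p"
    by (rule degree_add_eq_right lead_coeff_add_le)+
  moreover have "cheb_U (Suc (Suc n)) = - cheb_U n + ?p" by simp
  ultimately show ?case using d l by metis
qed auto

text \<open>The sines of consecutive multiples of \<open>t\<close> obey the recurrence of
  \<open>cheb_U\<close>, by the addition formulas.\<close>

lemma poly_cheb_U_cos: "poly (cheb_U n) (cos t) * sin t = sin (real (Suc n) * t)"
proof (induction n rule: cheb_U.induct)
  case (3 n)
  have "sin (real (Suc (Suc (Suc n))) * t) + sin (real (Suc n) * t)
      = 2 * cos t * sin (real (Suc (Suc n)) * t)"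
    using sin_add[of "real (Suc (Suc n)) * t" t] sin_diff[of "real (Suc (Suc n)) * t" t]
    by (simp add: algebra_simps)
  then show ?case using 3 by (simp add: algebra_simps)
qed (auto simp: sin_double)

lemma poly_cheb_U_1: "poly (cheb_U n) 1 = real n + 1"
  by (induction n rule: cheb_U.induct) auto

lemma poly_cheb_U_minus_1: "poly (cheb_U n) (-1) = (-1) ^ n * (real n + 1)"
  by (induction n rule: cheb_U.induct) (auto simp: algebra_simps)

text \<open>Both sides of \<open>poly_cheb_U_cos\<close> are differentiated in \<open>t\<close>; the
  chain rule supplies the second factor \<open>sin t\<close>.\<close>

lemma pderiv_cheb_U_cos:
  "poly (pderiv (cheb_U n)) (cos t) * (sin t)\<^sup>2
     = poly (cheb_U n) (cos t) * cos t - real (Suc n) * cos (real (Suc n) * t)"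
proof -
  have "((\<lambda>t. poly (cheb_U n) (cos t) * sin t) has_real_derivative
      poly (pderiv (cheb_U n)) (cos t) * (- sin t) * sin t + poly (cheb_U n) (cos t) * cos t) (at t)"
    by (auto intro!: derivative_eq_intros DERIV_chain2[OF poly_DERIV] simp: algebra_simps)
  moreover have "((\<lambda>t. sin (real (Suc n) * t)) has_real_derivative
      real (Suc n) * cos (real (Suc n) * t)) (at t)"
    by (auto intro!: derivative_eq_intros)
  ultimately have "poly (pderiv (cheb_U n)) (cos t) * (- sin t) * sin t
      + poly (cheb_U n) (cos t) * cos t = real (Suc n) * cos (real (Suc n) * t)"
    unfolding poly_cheb_U_cos by (rule DERIV_unique)
  then show ?thesis by (simp add: power2_eq_square algebra_simps)
qed

theorem theorem4:
  fixes n :: nat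
  assumes "n \<ge> 2"
  shows "lebesgue_function (CL_points (2 / real n) 0 n) (-1) = 2 * real n - 1"
proof -
  define t where "t j = real j * pi / real n" for j :: nat
  define X where "X = (\<lambda>j. cos (t j)) ` {..<n}"
  obtain m where n: "n = Suc m" and "m > 0" using assms by (cases n) auto
  \<comment> \<open>The choice of \<beta> makes \<open>2 - 2 / n = 2 * (n - 1) / n\<close>, which
    cancels the denominator.\<close>
  have "(2 - 2 / real n - 0) * real j * pi / (2 * (real n - 1)) + 0 * pi / 2 = t j" for j
    using assms by (simp add: t_def field_simps)
  moreover have "{0..n - 1} = {..<n}" using assms by auto
  ultimately have CL: "CL_points (2 / real n) 0 n = X"
    unfolding CL_points_def X_def by simp
  have t_bounds: "0 < t j" "t j < pi" if "j \<in> {1..<n}" for j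
    using that by (auto simp: t_def field_simps)
  have t_range: "0 \<le> t j" "t j \<le> pi" if "j < n" for j
    using that by (auto simp: t_def field_simps)
  have inj: "inj_on (\<lambda>j. cos (t j)) {..<n}"
  proof (rule inj_onI)
    fix i j assume "i \<in> {..<n}" "j \<in> {..<n}" "cos (t i) = cos (t j)"
    then have "t i = t j" using cos_inj_pi t_range by simp
    then show "i = j" using assms by (simp add: t_def)
  qed
  have card: "card X = n" and fin: "finite X"
    using card_image[OF inj] by (auto simp: X_def)
  define W where "W = [:-1, 1:] * cheb_U m"
  have nt: "real (Suc m) * t j = real j * pi" for j by (simp add: t_def n)
  \<comment> \<open>The index 0 is excluded because \<open>sin (t 0) = 0\<close>; its node 1 is the
    root of the linear factor of \<open>W\<close>.\<close>
  have U0: "poly (cheb_U m) (cos (t j)) = 0" if "j \<in> {1..<n}" for j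
  proof -
    have "poly (cheb_U m) (cos (t j)) * sin (t j) = 0"
      by (simp only: poly_cheb_U_cos nt) simp
    moreover have "sin (t j) > 0" using t_bounds[OF that] sin_gt_zero by blast
    ultimately show ?thesis by simp
  qed
  have roots: "poly W b = 0" if "b \<in> X" for b
  proof -
    obtain j where j: "j < n" "b = cos (t j)" using \<open>b \<in> X\<close> by (auto simp: X_def)
    show ?thesis
      using U0[of j] j by (cases "j = 0") (auto simp: W_def t_def)
  qed
  have "cheb_U m \<noteq> 0" using degree_lead_coeff_cheb_U[of m] \<open>m > 0\<close> by auto
  then have deg: "degree W = card X"
    using degree_lead_coeff_cheb_U[of m] by (simp add: W_def card n degree_mult_eq del: mult_pCons_left)
  have L: "lagrange_poly X a (-1) * ((-1 - a) * poly (pderiv W) a) = poly W (-1)" if "a \<in> X" for a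
    using lagrange_poly_eq_pderiv[OF fin roots deg that] .
  have W': "poly (pderiv W) x = poly (cheb_U m) x + (x - 1) * poly (pderiv (cheb_U m)) x" for x
    by (simp only: W_def pderiv_mult) (simp add: pderiv_pCons algebra_simps)
  have Wm1: "\<bar>poly W (-1)\<bar> = 2 * real n"
    by (simp add: W_def poly_cheb_U_minus_1 n abs_mult)
  have l0: "\<bar>lagrange_poly X (cos (t 0)) (-1)\<bar> = 1"
  proof -
    have "1 \<in> X" using assms by (auto simp: X_def t_def intro!: image_eqI[of _ _ 0])
    \<comment> \<open>At 1 the second summand of \<open>W'\<close> vanishes, leaving
      \<open>U 1 = n\<close>.\<close>
    have "\<bar>(-1 - 1) * poly (pderiv W) 1\<bar> = 2 * real n"
      by (simp add: W' poly_cheb_U_1 n)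
    with L[OF \<open>1 \<in> X\<close>] Wm1 have "\<bar>lagrange_poly X 1 (-1)\<bar> * (2 * real n) = 2 * real n"
      by (metis abs_mult)
    then show ?thesis using assms by (simp add: t_def)
  qed
  have lj: "\<bar>lagrange_poly X (cos (t j)) (-1)\<bar> = 2" if j: "j \<in> {1..<n}" for j
  proof -
    let ?a = "cos (t j)"
    \<comment> \<open>At a root of \<open>U\<close> only \<open>(a - 1) * U' a\<close> remains of
      \<open>W' a\<close>, and \<open>(-1 - a) * (a - 1) = 1 - a^2\<close> is the squared
      sine.\<close>
    have "(-1 - ?a) * poly (pderiv W) ?a = poly (pderiv (cheb_U m)) ?a * (sin (t j))\<^sup>2"
      unfolding W' sin_squared_eq using U0[OF j] by (simp add: power2_eq_square algebra_simps)
    also have "\<dots> = - real n * cos (real j * pi)"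
      unfolding pderiv_cheb_U_cos nt n using U0[OF j] by (simp add: algebra_simps)
    \<comment> \<open>Here \<open>cos (j * pi)\<close> is 1 or -1.\<close>
    finally have *: "\<bar>(-1 - ?a) * poly (pderiv W) ?a\<bar> = real n"
      by (simp add: abs_mult)
    have "?a \<in> X" using j by (auto simp: X_def)
    from L[OF this] have "\<bar>lagrange_poly X ?a (-1)\<bar> * real n = 2 * real n"
      using * Wm1 by (metis abs_mult)
    then show ?thesis using assms by simp
  qed
  have "lebesgue_function X (-1) = (\<Sum>j<n. \<bar>lagrange_poly X (cos (t j)) (-1)\<bar>)"
    unfolding lebesgue_function_def by (subst (1) X_def, subst sum.reindex[OF inj]) simp
  also have "\<dots> = 1 + (\<Sum>j\<in>{1..<n}. \<bar>lagrange_poly X (cos (t j)) (-1)\<bar>)"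
    using assms l0 by (simp add: lessThan_atLeast0 sum.atLeast_Suc_lessThan)
  also have "(\<Sum>j\<in>{1..<n}. \<bar>lagrange_poly X (cos (t j)) (-1)\<bar>) = (\<Sum>j\<in>{1..<n}. 2)"
    using lj by (intro sum.cong) auto
  finally show ?thesis
    using assms CL by (simp add: of_nat_diff)
qed

end
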